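(* Let $\mathcal V_{W\dot WM_uM_y}$ be a generalized dynamical system, $\mathcal V_{WM_u}$ a linear subspace of vectors on $W\uplus M_u$, and $\mathcal V_{W\dot W}$ a genaut. Then $$\mathcal V_{W\dot W}=(\mathcal V_{W\dot WM_uM_y}\cap\mathcal V_{WM_u})\circ W\dot W$$ if and only if $$\mathcal V^a_{W'\dot W'}=\bigl(\mathcal V^a_{W'\dot W'M_u'M_y'}+(\mathcal V_{WM_u}^{\perp})_{\dot W'M_y'}\bigr)\times W'\dot W'.$$
   Context: Fix a field $\mathbb F$; all index sets are finite. A vector on $X$ is a function $X\to\mathbb F$. $W,\dot W$ are disjoint sets that are copies of each other (in bijection). A generalized dynamical system $\mathcal V_{W\dot WM_uM_y}$ is a linear subspace of vectors on $W\uplus\dot W\uplus M_u\uplus M_y$; a genaut is a linear subspace of vectors on $W\uplus\dot W$. For $T\subseteq S$: $\mathcal V_S\circ T$ is the set of restrictions to $T$ of vectors in $\mathcal V_S$; $\mathcal V_S\times T:=\{f_T:(f_T,0_{S\setminus T})\in\mathcal V_S\}$. For spaces on different index sets: $\mathcal V_X+\mathcal V_Y$ is on $X\cup Y$ and is formed after extending the vectors of each by zero; $\mathcal V_X\cap\mathcal V_Y$ is the set of vectors on $X\cup Y$ whose restriction to $X$ is in $\mathcal V_X$ and whose restriction to $Y$ is in $\mathcal V_Y$. $\mathcal V^\perp$ is the orthogonal complement with respect to the dot product. Adjoint: $W',\dot W'$ are disjoint copies of $W$; $M_u',M_y'$ are disjoint sets which are copies of $M_y,M_u$ respectively. $\mathcal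 V^a_{W'\dot W'M_u'M_y'}:=(\mathcal V^\perp_{W\dot WM_uM_y})_{-\dot W'\,W'\,-M_y'\,M_u'}$: each vector $(f_W,g_{\dot W},h_{M_u},k_{M_y})$ of $\mathcal V^\perp$ becomes the vector with $\dot W'$-component $-f$, $W'$-component $g$, $M_y'$-component $-h$, $M_u'$-component $k$. Similarly $\mathcal V^a_{W'\dot W'}:=(\mathcal V^\perp_{W\dot W})_{-\dot W'W'}$. $(\mathcal V_{WM_u}^\perp)_{\dot W'M_y'}$ is $\mathcal V_{WM_u}^\perp$ with $W$ relabelled as $\dot W'$ and $M_u$ relabelled as $M_y'$. *)

theory Defs
  imports Complex_Main "HOL-Library.Function_Algebras" "HOL-Library.Set_Algebras"
begin

text \<open>
  A vector on an index set \<open>X \<subseteq> UNIV :: 'i set\<close> is encoded as a function \<open>'i \<Rightarrow> 'a\<close> that vanishes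
  outside \<open>X\<close>. Extending a vector by zero to a larger index set therefore leaves the encoding
  unchanged, and the sum of two spaces on different index sets is the elementwise sum
  \<open>V + U\<close> of \<open>Set_Algebras\<close>.
\<close>

definition vecs :: "'i set \<Rightarrow> ('i \<Rightarrow> 'a::zero) set" where
  "vecs X = {f. \<forall>i. i \<notin> X \<longrightarrow> f i = 0}"

definition vspace_on :: "'i set \<Rightarrow> ('i \<Rightarrow> 'a::field) set \<Rightarrow> bool" where
  "vspace_on X V \<longleftrightarrow> V \<subseteq> vecs X \<and> module.subspace (\<lambda>c f i. c * f i) V"

definition restr :: "'i set \<Rightarrow> ('i \<Rightarrow> 'a::zero) \<Rightarrow> 'i \<Rightarrow> 'a" where
  "restr T f = (\<lambda>i. if i \<in> T then f i else 0)"

text \<open>\<open>V \<circ> T\<close>\<close>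

definition restriction :: "('i \<Rightarrow> 'a::zero) set \<Rightarrow> 'i set \<Rightarrow> ('i \<Rightarrow> 'a) set" where
  "restriction V T = restr T ` V"

text \<open>\<open>V \<times> T\<close>: for \<open>V\<close> on \<open>S \<supseteq> T\<close>, the vector \<open>(f\<^sub>T, 0)\<close> on \<open>S\<close> has the same encoding as \<open>f\<^sub>T\<close>.\<close>

definition contraction :: "('i \<Rightarrow> 'a::zero) set \<Rightarrow> 'i set \<Rightarrow> ('i \<Rightarrow> 'a) set" where
  "contraction V T = {f \<in> vecs T. f \<in> V}"

text \<open>The intersection \<open>V \<inter> U\<close> of spaces on different index sets \<open>X\<close> and \<open>Y\<close>; it is not the
  set-theoretic intersection of the encodings.\<close>

definition meet :: "'i set \<Rightarrow> ('i \<Rightarrow> 'a::zero) set \<Rightarrow> 'i set \<Rightarrow> ('i \<Rightarrow> 'a) set \<Rightarrow> ('i \<Rightarrow> 'a) set" where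
  "meet X V Y U = {f \<in> vecs (X \<union> Y). restr X f \<in> V \<and> restr Y f \<in> U}"

definition orth :: "'i set \<Rightarrow> ('i \<Rightarrow> 'a::field) set \<Rightarrow> ('i \<Rightarrow> 'a) set" where
  "orth X V = {g \<in> vecs X. \<forall>f\<in>V. (\<Sum>i\<in>X. f i * g i) = 0}"

text \<open>Relabelling of a space on \<open>A \<uplus> B\<close> along \<open>\<phi>\<close> on \<open>A\<close> and \<open>\<psi>\<close> on \<open>B\<close>.\<close>

definition relabel ::
  "'i set \<Rightarrow> ('i \<Rightarrow> 'i) \<Rightarrow> 'i set \<Rightarrow> ('i \<Rightarrow> 'i) \<Rightarrow> ('i \<Rightarrow> 'a::zero) set \<Rightarrow> ('i \<Rightarrow> 'a) set" where
  "relabel A \<phi> B \<psi> V = {g \<in> vecs (\<phi> ` A \<union> \<psi> ` B).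
     \<exists>f\<in>V. (\<forall>a\<in>A. g (\<phi> a) = f a) \<and> (\<forall>b\<in>B. g (\<psi> b) = f b)}"

text \<open>
  In the adjoints, \<open>dot\<close> maps \<open>W\<close> to its copy \<open>\<dot>W\<close>, \<open>prm\<close> maps \<open>W\<close> to \<open>W'\<close>, \<open>dot'\<close> maps \<open>W'\<close>
  to its copy \<open>\<dot>W'\<close>, \<open>yu\<close> maps \<open>M\<^sub>y\<close> to \<open>M\<^sub>u'\<close>, and \<open>uy\<close> maps \<open>M\<^sub>u\<close> to \<open>M\<^sub>y'\<close>. So \<open>w \<in> W\<close>
  corresponds to \<open>dot' (prm w) \<in> \<dot>W'\<close>, and \<open>dot w \<in> \<dot>W\<close> corresponds to \<open>prm w \<in> W'\<close>.
\<close>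

definition adjoint_genaut ::
  "'i set \<Rightarrow> ('i \<Rightarrow> 'i) \<Rightarrow> ('i \<Rightarrow> 'i) \<Rightarrow> ('i \<Rightarrow> 'i) \<Rightarrow> ('i \<Rightarrow> 'a::field) set \<Rightarrow> ('i \<Rightarrow> 'a) set" where
  "adjoint_genaut W dot prm dot' V =
     {g \<in> vecs (prm ` W \<union> dot' ` prm ` W).
        \<exists>f\<in>orth (W \<union> dot ` W) V.
          (\<forall>w\<in>W. g (dot' (prm w)) = - f w \<and> g (prm w) = f (dot w))}"

definition adjoint_gds ::
  "'i set \<Rightarrow> 'i set \<Rightarrow> 'i set \<Rightarrow> ('i \<Rightarrow> 'i) \<Rightarrow> ('i \<Rightarrow> 'i) \<Rightarrow> ('i \<Rightarrow> 'i) \<Rightarrow> ('i \<Rightarrow> 'i) \<Rightarrow> ('i \<Rightarrow> 'i)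
    \<Rightarrow> ('i \<Rightarrow> 'a::field) set \<Rightarrow> ('i \<Rightarrow> 'a) set" where
  "adjoint_gds W Mu My dot prm dot' yu uy V =
     {g \<in> vecs (prm ` W \<union> dot' ` prm ` W \<union> yu ` My \<union> uy ` Mu).
        \<exists>f\<in>orth (W \<union> dot ` W \<union> Mu \<union> My) V.
          (\<forall>w\<in>W. g (dot' (prm w)) = - f w \<and> g (prm w) = f (dot w)) \<and>
          (\<forall>m\<in>Mu. g (uy m) = - f m) \<and>
          (\<forall>m\<in>My. g (yu m) = f m)}"

end

theory Submission
  imports Defs
begin

text \<open>
  The theorem combines two dualities with a change of coordinates.

  Let \<open>S\<close>, \<open>P\<close> and \<open>T\<close> be the index sets of the system \<open>V\<close>, of \<open>U = VWMu\<close> and of the genaut. For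
  subspaces of a finite-dimensional coordinate space, \<open>V\<^sup>\<bottom>\<^sup>\<bottom> = V\<close> (\<open>orth_orth\<close>). Hence taking
  orthogonal complements turns intersections into sums (\<open>orth_meet\<close>), and it turns restrictions into
  contractions (\<open>orth_restriction\<close>), so the complement of \<open>(V \<inter> U) \<circ> T\<close> is \<open>(V\<^sup>\<bottom> + U\<^sup>\<bottom>) \<times> T\<close>. A genaut
  is equal to the former iff its complement is equal to the latter.

  The adjoints are these complements, seen through a single bijection of index sets combined with a
  change of sign on the coordinates in \<open>P\<close>. The relabelled space \<open>U\<^sup>\<bottom>\<close> is obtained through the same
  signed bijection: all its coordinates lie in \<open>P\<close> and change sign, and a subspace is invariant under
  negation. A signed bijection commutes with sums and contractions (\<open>contraction_preimage_sum\<close>) and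
  maps distinct spaces to distinct spaces (\<open>preimage_eq_iff\<close>), so the two equations correspond.
\<close>

section \<open>Orthogonal complements in a coordinate space\<close>

interpretation fun_space: vector_space "\<lambda>c (f :: 'i \<Rightarrow> 'a::field) i. c * f i"
  by unfold_locales (auto simp: fun_eq_iff algebra_simps)

lemma restr_in_vecs [simp]: "restr X f \<in> vecs X"
  by (simp add: restr_def vecs_def)

lemma restr_zero: "restr X 0 = 0"
  by (auto simp: restr_def)

lemma restr_add: "restr X (f + g) = restr X f + restr X (g :: 'i \<Rightarrow> 'a::field)"
  by (auto simp: restr_def)

lemma restr_scale: "restr X (\<lambda>i. c * f i) = (\<lambda>i. c * restr X f i :: 'a::field)"
  by (auto simp: restr_def)

lemma vecs_mono: "X \<subseteq> Y \<Longrightarrow> vecs X \<subseteq> vecs Y"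
  by (auto simp: vecs_def)

lemma vspace_on_iff:
  "vspace_on X V \<longleftrightarrow> V \<subseteq> vecs X \<and> 0 \<in> V \<and> (\<forall>f\<in>V. \<forall>g\<in>V. f + g \<in> V) \<and>
    (\<forall>c. \<forall>f\<in>V. (\<lambda>i. c * f i) \<in> V)"
  by (auto simp: vspace_on_def fun_space.subspace_def)

lemma vspace_on_uminus:
  assumes "vspace_on X V" "f \<in> V" shows "(\<lambda>i. - f i) \<in> V"
proof -
  have "(\<lambda>i. -1 * f i) \<in> V"
    using assms unfolding vspace_on_iff by blast
  then show ?thesis by simp
qed

lemma vspace_on_orth: "vspace_on X (orth X V)"
  by (auto simp: vspace_on_iff orth_def vecs_def algebra_simps sum.distrib
      simp flip: sum_distrib_left)

lemma vspace_on_sum: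
  assumes "vspace_on X V" "vspace_on Y U"
  shows "vspace_on (X \<union> Y) (V + U)"
proof -
  have "V + U = {v + u |v u. v \<in> V \<and> u \<in> U}"
    by (auto simp: set_plus_def)
  then have "module.subspace (\<lambda>c f i. c * f i) (V + U)"
    using fun_space.subspace_sums[of V U] assms by (simp add: vspace_on_def)
  moreover have "V + U \<subseteq> vecs (X \<union> Y)"
    using assms by (fastforce simp: vspace_on_def set_plus_def vecs_def)
  ultimately show ?thesis
    by (simp add: vspace_on_def)
qed

lemma vspace_on_meet:
  assumes "vspace_on X V" "vspace_on Y U"
  shows "vspace_on (X \<union> Y) (meet X V Y U)"
  using assms unfolding vspace_on_iff meet_def
  by (auto simp: vecs_def restr_add restr_scale restr_zero)

lemma vspace_on_restriction:
  assumes "vspace_on X V" shows "vspace_on T (restriction V T)"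
proof -
  have "0 \<in> restr T ` V"
    using assms restr_zero[of T] unfolding vspace_on_iff by (metis image_eqI)
  then show ?thesis
    using assms unfolding vspace_on_iff restriction_def
    by (auto simp flip: restr_add restr_scale)
qed

text \<open>
  A vector \<open>f \<notin> V\<close> is separated from \<open>V\<close> by a linear functional. On vectors indexed by the finite
  set \<open>X\<close> this functional is the dot product with the vector of its values at the unit vectors.
\<close>

lemma orth_separates:
  assumes X: "finite X" and V: "vspace_on X V" and f: "f \<in> vecs X" "f \<notin> V"
  shows "\<exists>g\<in>orth X V. (\<Sum>i\<in>X. f i * g i) = 1"
proof -
  interpret P: vector_space_pair "\<lambda>c (f :: 'a \<Rightarrow> 'b) i. c * f i" "(*) :: 'b \<Rightarrow> 'b \<Rightarrow> 'b"
    by unfold_locales (auto simp: algebra_simps)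
  have subV: "fun_space.subspace V"
    using V by (simp add: vspace_on_def)
  obtain B where B: "B \<subseteq> V" "fun_space.independent B" "V \<subseteq> fun_space.span B"
    using fun_space.basis_exists[of V] by metis
  have spanB: "fun_space.span B = V"
    using B fun_space.span_minimal[OF B(1) subV] by auto
  have ind: "fun_space.independent (insert f B)"
    using B(2) f(2) by (intro fun_space.independent_insertI) (auto simp: spanB)
  obtain \<phi> where lin: "Vector_Spaces.linear (\<lambda>c f i. c * f i) (*) \<phi>"
    and \<phi>: "\<forall>x\<in>insert f B. \<phi> x = (if x = f then 1 else 0)"
    using P.linear_independent_extend[OF ind, of "\<lambda>x. if x = f then 1 else 0"] by blast
  have fB: "f \<notin> B"
    using f(2) B(1) by blast
  have \<phi>V: "\<phi> v = 0" if "v \<in> V" for v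
  proof -
    have "\<phi> b = 0" if "b \<in> B" for b
      using \<phi> fB that by auto
    then show ?thesis
      using P.linear_eq_0_on_span[OF lin, of B v] that spanB by blast
  qed
  define e where "e = (\<lambda>(i :: 'a) j. if j = i then 1 else 0 :: 'b)"
  have \<phi>_sum: "\<phi> h = (\<Sum>i\<in>X. h i * \<phi> (e i))" if "h \<in> vecs X" for h
  proof -
    have "h = (\<Sum>i\<in>X. (\<lambda>j. h i * e i j))"
    proof
      fix j
      have "(\<Sum>i\<in>X. (\<lambda>j. h i * e i j)) j = (\<Sum>i\<in>X. h i * e i j)"
        using X by (induction X rule: finite_induct) auto
      also have "\<dots> = (\<Sum>i\<in>X. if j = i then h i else 0)"
        by (intro sum.cong) (auto simp: e_def)
      also have "\<dots> = h j"
        using X that by (auto simp: vecs_def)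
      finally show "h j = (\<Sum>i\<in>X. (\<lambda>j. h i * e i j)) j" ..
    qed
    then have "\<phi> h = \<phi> (\<Sum>i\<in>X. (\<lambda>j. h i * e i j))"
      by simp
    also have "\<dots> = (\<Sum>i\<in>X. h i * \<phi> (e i))"
      by (simp add: P.linear_sum[OF lin] P.linear_scale[OF lin])
    finally show ?thesis .
  qed
  define g where "g = restr X (\<lambda>i. \<phi> (e i))"
  have dot_g: "(\<Sum>i\<in>X. h i * g i) = \<phi> h" if "h \<in> vecs X" for h
    unfolding \<phi>_sum[OF that] by (auto simp: g_def restr_def)
  have "g \<in> orth X V"
    using V \<phi>V dot_g by (auto simp: orth_def g_def vspace_on_def)
  moreover have "(\<Sum>i\<in>X. f i * g i) = 1"
    using dot_g f(1) \<phi> by simp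
  ultimately show ?thesis by blast
qed

lemma orth_orth:
  assumes "finite X" "vspace_on X V"
  shows "orth X (orth X V) = V"
proof (intro subset_antisym subsetI)
  fix f assume "f \<in> orth X (orth X V)"
  then have "f \<in> vecs X" "\<And>g. g \<in> orth X V \<Longrightarrow> (\<Sum>i\<in>X. f i * g i) = 0"
    by (auto simp: orth_def mult.commute)
  then show "f \<in> V"
    using orth_separates[OF assms] by fastforce
next
  fix f assume "f \<in> V"
  then show "f \<in> orth X (orth X V)"
    using assms by (auto simp: orth_def vspace_on_def mult.commute)
qed

lemma orth_eq_iff:
  assumes "finite X" "vspace_on X V" "vspace_on X U"
  shows "orth X V = orth X U \<longleftrightarrow> V = U"
  using assms orth_orth by metis

lemma sum_restr_mult:
  assumes "finite S" "X \<subseteq> S" "a \<in> vecs X"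
  shows "(\<Sum>i\<in>S. f i * a i) = (\<Sum>i\<in>X. restr X f i * (a i :: 'a::field))"
proof -
  have "(\<Sum>i\<in>S. f i * a i) = (\<Sum>i\<in>X. f i * a i)"
    using assms by (intro sum.mono_neutral_right) (auto simp: vecs_def)
  then show ?thesis
    by (simp add: restr_def)
qed

text \<open>
  Both \<open>V\<close> and \<open>U\<close> are complements of their complements, so a vector lies in their intersection iff
  it is orthogonal to \<open>V\<^sup>\<bottom>\<close> and \<open>U\<^sup>\<bottom>\<close>, that is, to \<open>V\<^sup>\<bottom> + U\<^sup>\<bottom>\<close>. Taking complements once more gives
  the claim.
\<close>

lemma orth_meet:
  assumes fin: "finite X" "finite Y" and V: "vspace_on X V" and U: "vspace_on Y U"
  shows "orth (X \<union> Y) (meet X V Y U) = orth X V + orth Y U"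
proof -
  have sum0: "(\<Sum>i\<in>X\<union>Y. (a + b) i * f i)
      = (\<Sum>i\<in>X. a i * restr X f i) + (\<Sum>i\<in>Y. b i * restr Y f i)"
    if "a \<in> orth X V" "b \<in> orth Y U" for a b f
    using sum_restr_mult[of "X \<union> Y" X a f] sum_restr_mult[of "X \<union> Y" Y b f] fin that
    by (simp add: orth_def algebra_simps sum.distrib)
  have zero: "0 \<in> orth X V" "0 \<in> orth Y U"
    by (auto simp: orth_def vecs_def)
  have "f \<in> meet X V Y U \<longleftrightarrow> f \<in> orth (X \<union> Y) (orth X V + orth Y U)" for f
  proof -
    have "f \<in> meet X V Y U \<longleftrightarrow> f \<in> vecs (X \<union> Y) \<and>
        restr X f \<in> orth X (orth X V) \<and> restr Y f \<in> orth Y (orth Y U)"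
      using orth_orth[OF fin(1) V] orth_orth[OF fin(2) U] by (simp add: meet_def)
    also have "\<dots> \<longleftrightarrow> f \<in> vecs (X \<union> Y) \<and>
        (\<forall>a\<in>orth X V. (\<Sum>i\<in>X. a i * restr X f i) = 0) \<and>
        (\<forall>b\<in>orth Y U. (\<Sum>i\<in>Y. b i * restr Y f i) = 0)"
      by (simp add: orth_def[of _ "orth _ _"])
    also have "\<dots> \<longleftrightarrow> f \<in> vecs (X \<union> Y) \<and>
        (\<forall>a\<in>orth X V. \<forall>b\<in>orth Y U.
          (\<Sum>i\<in>X. a i * restr X f i) + (\<Sum>i\<in>Y. b i * restr Y f i) = 0)"
    proof -
      \<comment> \<open>each summand is isolated by taking the other vector to be zero\<close>
      have "(\<Sum>i\<in>X. a i * restr X f i) = 0 \<and> (\<Sum>i\<in>Y. b i * restr Y f i) = 0"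
        if *: "\<forall>a\<in>orth X V. \<forall>b\<in>orth Y U.
          (\<Sum>i\<in>X. a i * restr X f i) + (\<Sum>i\<in>Y. b i * restr Y f i) = 0"
          and "a \<in> orth X V" "b \<in> orth Y U" for a b
        using *[rule_format, OF zero(1) that(3)] *[rule_format, OF that(2) zero(2)] by simp
      then show ?thesis
        using zero by auto
    qed
    also have "\<dots> \<longleftrightarrow> f \<in> vecs (X \<union> Y) \<and>
        (\<forall>a\<in>orth X V. \<forall>b\<in>orth Y U. (\<Sum>i\<in>X\<union>Y. (a + b) i * f i) = 0)"
      using sum0 by (auto simp del: plus_fun_apply)
    also have "\<dots> \<longleftrightarrow> f \<in> orth (X \<union> Y) (orth X V + orth Y U)"
      unfolding orth_def[of "X \<union> Y"]
      by (auto simp del: plus_fun_apply elim!: set_plus_elim intro: set_plus_intro)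
    finally show ?thesis .
  qed
  then have "meet X V Y U = orth (X \<union> Y) (orth X V + orth Y U)"
    by blast
  then show ?thesis
    using orth_orth[OF finite_UnI[OF fin]
        vspace_on_sum[OF vspace_on_orth[of X V] vspace_on_orth[of Y U]]] by simp
qed

text \<open>
  For \<open>g\<close> supported on \<open>T\<close>, the dot products of \<open>g\<close> with \<open>f\<close> and with the restriction of \<open>f\<close> to
  \<open>T\<close> agree, so orthogonality to the restricted space is orthogonality to \<open>V\<close> itself.
\<close>

lemma orth_restriction:
  assumes "finite S" "T \<subseteq> S"
  shows "orth T (restriction V T) = contraction (orth S V) T"
  using sum_restr_mult[OF assms] vecs_mono[OF assms(2)]
  by (auto simp: orth_def restriction_def contraction_def)


section \<open>Signed relabellings\<close>

text \<open>
  A relabelling by \<open>\<sigma>\<close> moves coordinates from \<open>S\<close> to \<open>\<sigma> ` S\<close>. It is expressed through the map in the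
  opposite direction, which needs no inverse of \<open>\<sigma>\<close>: a relabelled space consists of the vectors
  whose pullback lies in the original space.
\<close>

definition signed_pullback ::
  "'i set \<Rightarrow> ('i \<Rightarrow> 'i) \<Rightarrow> ('i \<Rightarrow> 'a::field) \<Rightarrow> ('i \<Rightarrow> 'a) \<Rightarrow> 'i \<Rightarrow> 'a" where
  "signed_pullback S \<sigma> \<epsilon> g = restr S (\<lambda>i. \<epsilon> i * g (\<sigma> i))"

lemma signed_pullback_add:
  "signed_pullback S \<sigma> \<epsilon> (g + h) = signed_pullback S \<sigma> \<epsilon> g + signed_pullback S \<sigma> \<epsilon> h"
  by (auto simp: signed_pullback_def restr_def algebra_simps)

lemma bij_betw_signed_pullback:
  assumes inj: "inj_on \<sigma> S" and nz: "\<forall>i\<in>S. \<epsilon> i \<noteq> 0" and T: "T \<subseteq> S"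
  shows "bij_betw (signed_pullback S \<sigma> \<epsilon>) (vecs (\<sigma> ` T)) (vecs T)"
proof (rule bij_betw_byWitness[where f' = "\<lambda>f j. if j \<in> \<sigma> ` T
        then f (inv_into S \<sigma> j) / \<epsilon> (inv_into S \<sigma> j) else 0"], goal_cases)
  case 1
  have "inv_into S \<sigma> (\<sigma> i) = i" "\<epsilon> i \<noteq> 0" "i \<in> S" if "i \<in> T" for i
    using that T inj nz by auto
  then show ?case
    by (auto simp: signed_pullback_def restr_def vecs_def fun_eq_iff)
next
  case 2
  have "inv_into S \<sigma> (\<sigma> i) = i" "\<epsilon> i \<noteq> 0" "\<sigma> i \<in> \<sigma> ` T \<longleftrightarrow> i \<in> T" if "i \<in> S" for i
    using that T inj nz by (auto simp: inj_on_def)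
  then show ?case
    using T by (auto simp: signed_pullback_def restr_def vecs_def fun_eq_iff)
next
  case 3
  have "\<sigma> i \<in> \<sigma> ` T \<longleftrightarrow> i \<in> T" if "i \<in> S" for i
    using that T inj by (auto simp: inj_on_def)
  then show ?case
    by (auto simp: signed_pullback_def restr_def vecs_def)
next
  case 4
  show ?case
    by (auto simp: vecs_def)
qed

definition signed_preimage ::
  "'i set \<Rightarrow> ('i \<Rightarrow> 'i) \<Rightarrow> ('i \<Rightarrow> 'a::field) \<Rightarrow> 'i set \<Rightarrow> ('i \<Rightarrow> 'a) set \<Rightarrow> ('i \<Rightarrow> 'a) set" where
  "signed_preimage S \<sigma> \<epsilon> T A = {g \<in> vecs (\<sigma> ` T). signed_pullback S \<sigma> \<epsilon> g \<in> A}"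

text \<open>
  The pullback is onto the vectors on \<open>T\<close>, so a space there is recovered as the image of its preimage.
\<close>

lemma preimage_eq_iff:
  assumes "inj_on \<sigma> S" "\<forall>i\<in>S. \<epsilon> i \<noteq> 0" "T \<subseteq> S" "A \<subseteq> vecs T" "B \<subseteq> vecs T"
  shows "signed_preimage S \<sigma> \<epsilon> T A = signed_preimage S \<sigma> \<epsilon> T B \<longleftrightarrow> A = B"
proof -
  have "signed_pullback S \<sigma> \<epsilon> ` signed_preimage S \<sigma> \<epsilon> T C = C" if "C \<subseteq> vecs T" for C
    using bij_betw_imp_surj_on[OF bij_betw_signed_pullback[OF assms(1-3)]] that
    by (auto simp: signed_preimage_def)
  then show ?thesis
    using assms(4,5) by metis
qed

text \<open>
  A summand of the pulled-back vector lifts along \<open>\<sigma>\<close> without leaving its own index set, and the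
  lifts add up to the original vector because the pullback is additive and injective.
\<close>

lemma contraction_preimage_sum:
  assumes inj: "inj_on \<sigma> S" and nz: "\<forall>i\<in>S. \<epsilon> i \<noteq> 0"
    and sub: "X \<subseteq> S" "Y \<subseteq> S" "T \<subseteq> S" and A: "A \<subseteq> vecs X" and B: "B \<subseteq> vecs Y"
  shows "contraction (signed_preimage S \<sigma> \<epsilon> X A + signed_preimage S \<sigma> \<epsilon> Y B) (\<sigma> ` T)
    = signed_preimage S \<sigma> \<epsilon> T (contraction (A + B) T)"
proof -
  let ?p = "signed_pullback S \<sigma> \<epsilon>"
  have p: "bij_betw ?p (vecs (\<sigma> ` Z)) (vecs Z)" if "Z \<subseteq> S" for Z
    using bij_betw_signed_pullback[OF inj nz that] .
  have in_vecs: "?p g \<in> vecs T" if "g \<in> vecs (\<sigma> ` T)" for g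
    using p[OF sub(3)] that by (auto simp: bij_betw_def)
  show ?thesis
  proof (intro subset_antisym subsetI)
    fix g assume "g \<in> contraction (signed_preimage S \<sigma> \<epsilon> X A + signed_preimage S \<sigma> \<epsilon> Y B) (\<sigma> ` T)"
    then show "g \<in> signed_preimage S \<sigma> \<epsilon> T (contraction (A + B) T)"
      using in_vecs
      by (auto simp: contraction_def signed_preimage_def signed_pullback_add
          elim!: set_plus_elim intro: set_plus_intro)
  next
    fix g assume "g \<in> signed_preimage S \<sigma> \<epsilon> T (contraction (A + B) T)"
    then obtain a b where g: "g \<in> vecs (\<sigma> ` T)" "?p g = a + b" and ab: "a \<in> A" "b \<in> B"
      by (auto simp: contraction_def signed_preimage_def set_plus_def)
    have "a \<in> ?p ` vecs (\<sigma> ` X)" "b \<in> ?p ` vecs (\<sigma> ` Y)"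
      using A B ab bij_betw_imp_surj_on[OF p[OF sub(1)]] bij_betw_imp_surj_on[OF p[OF sub(2)]]
      by auto
    then obtain a' b' where a': "a' \<in> vecs (\<sigma> ` X)" "?p a' = a"
      and b': "b' \<in> vecs (\<sigma> ` Y)" "?p b' = b"
      by blast
    have "g \<in> vecs (\<sigma> ` S)" "a' \<in> vecs (\<sigma> ` S)" "b' \<in> vecs (\<sigma> ` S)"
      using g(1) a'(1) b'(1) sub by (meson image_mono subsetD vecs_mono)+
    then have "g \<in> vecs (\<sigma> ` S)" "a' + b' \<in> vecs (\<sigma> ` S)"
      by (auto simp: vecs_def)
    moreover have "?p g = ?p (a' + b')"
      by (simp add: signed_pullback_add a' b' g)
    ultimately have "g = a' + b'"
      using p[OF subset_refl] by (auto simp: bij_betw_def inj_on_def)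
    then show "g \<in> contraction (signed_preimage S \<sigma> \<epsilon> X A + signed_preimage S \<sigma> \<epsilon> Y B) (\<sigma> ` T)"
      using g a' b' ab by (auto simp: contraction_def signed_preimage_def intro!: set_plus_intro)
  qed
qed


section \<open>Adjoints and the duality theorem\<close>

theorem theorem35:
  fixes W Wd Mu My W' Wd' Mu' My' :: "'i set"
    and dot prm dot' yu uy :: "'i \<Rightarrow> 'i"
    and V VWMu VWWd :: "('i \<Rightarrow> 'a::field) set"
  assumes "finite W" and "finite Mu" and "finite My"
    and "sorted_wrt disjnt [W, Wd, Mu, My]"
    and "sorted_wrt disjnt [W', Wd', Mu', My']"
    and "bij_betw dot W Wd"
    and "bij_betw prm W W'"
    and "bij_betw dot' W' Wd'"
    and "bij_betw yu My Mu'"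
    and "bij_betw uy Mu My'"
    and "vspace_on (W \<union> Wd \<union> Mu \<union> My) V"
    and "vspace_on (W \<union> Mu) VWMu"
    and "vspace_on (W \<union> Wd) VWWd"
  shows "VWWd = restriction (meet (W \<union> Wd \<union> Mu \<union> My) V (W \<union> Mu) VWMu) (W \<union> Wd)
    \<longleftrightarrow>
    adjoint_genaut W dot prm dot' VWWd =
      contraction
        (adjoint_gds W Mu My dot prm dot' yu uy V
          + relabel W (dot' \<circ> prm) Mu uy (orth (W \<union> Mu) VWMu))
        (W' \<union> Wd')"
proof -
  let ?S = "W \<union> Wd \<union> Mu \<union> My" and ?T = "W \<union> Wd" and ?P = "W \<union> Mu"
  have disj: "W \<inter> Wd = {}" "W \<inter> Mu = {}" "W \<inter> My = {}" "Wd \<inter> Mu = {}" "Wd \<inter> My = {}" "Mu \<inter> My = {}"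
    and disj': "W' \<inter> Wd' = {}" "W' \<inter> Mu' = {}" "W' \<inter> My' = {}" "Wd' \<inter> Mu' = {}" "Wd' \<inter> My' = {}"
      "Mu' \<inter> My' = {}"
    using assms(4,5) by (auto simp: disjnt_def)
  have Wd: "dot ` W = Wd" and W': "prm ` W = W'" and Wd': "dot' ` W' = Wd'" and Mu': "yu ` My = Mu'"
    and My': "uy ` Mu = My'"
    using assms(6-10) by (auto simp: bij_betw_def)
  have inj_dot: "inj_on dot W"
    using assms(6) by (simp add: bij_betw_def)
  have fin: "finite ?S" "finite ?P" "finite ?T"
    using assms(1-3) Wd by auto

  \<comment> \<open>one relabelling for all three spaces; it swaps dotted with undotted indices and inputs with
    outputs: \<open>W\<close>, \<open>Wd\<close>, \<open>Mu\<close>, \<open>My\<close> go to \<open>Wd'\<close>, \<open>W'\<close>, \<open>My'\<close>, \<open>Mu'\<close>\<close>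
  define \<sigma> where "\<sigma> = (\<lambda>i. if i \<in> W then dot' (prm i) else if i \<in> Wd then prm (inv_into W dot i)
    else if i \<in> Mu then uy i else yu i)"
  define \<epsilon> where "\<epsilon> = (\<lambda>i. if i \<in> ?P then -1 else 1 :: 'a)"
  have nz: "\<forall>i\<in>?S. \<epsilon> i \<noteq> 0"
    by (simp add: \<epsilon>_def)
  have \<sigma>_W: "\<sigma> w = dot' (prm w)" and \<sigma>_Wd: "\<sigma> (dot w) = prm w" if "w \<in> W" for w
    using that disj(1) Wd inj_dot by (auto simp: \<sigma>_def)
  have \<sigma>_Mu: "\<sigma> m = uy m" if "m \<in> Mu" for m
    using that disj by (auto simp: \<sigma>_def)
  have \<sigma>_My: "\<sigma> m = yu m" if "m \<in> My" for m
    using that disj by (auto simp: \<sigma>_def)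
  have \<epsilon>: "\<epsilon> i = -1" if "i \<in> ?P" for i
    using that by (simp add: \<epsilon>_def)
  have \<epsilon>': "\<epsilon> i = 1" if "i \<in> Wd \<union> My" for i
    using that disj by (auto simp: \<epsilon>_def)

  have bij_W: "bij_betw \<sigma> W Wd'"
    using bij_betw_trans[OF assms(7,8)] by (rule bij_betw_cong[THEN iffD1, rotated]) (simp add: \<sigma>_W)
  have bij_Wd: "bij_betw \<sigma> Wd W'"
  proof -
    have "bij_betw (prm \<circ> inv_into W dot) Wd W'"
      using bij_betw_trans[OF bij_betw_inv_into[OF assms(6)] assms(7)] .
    then show ?thesis
      using disj(1) by (elim bij_betw_cong[THEN iffD1, rotated]) (auto simp: \<sigma>_def)
  qed
  have bij_Mu: "bij_betw \<sigma> Mu My'"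
    using assms(10) by (rule bij_betw_cong[THEN iffD1, rotated]) (simp add: \<sigma>_Mu)
  have bij_My: "bij_betw \<sigma> My Mu'"
    using assms(9) by (rule bij_betw_cong[THEN iffD1, rotated]) (simp add: \<sigma>_My)
  have "bij_betw \<sigma> ?S (Wd' \<union> W' \<union> My' \<union> Mu')"
    using disj' by (intro bij_betw_combine bij_W bij_Wd bij_Mu bij_My) auto
  then have inj: "inj_on \<sigma> ?S"
    by (simp add: bij_betw_def)
  have img: "\<sigma> ` W = Wd'" "\<sigma> ` Wd = W'" "\<sigma> ` Mu = My'" "\<sigma> ` My = Mu'"
    using bij_W bij_Wd bij_Mu bij_My by (auto simp: bij_betw_def)

  let ?p = "signed_pullback ?S \<sigma> \<epsilon>" and ?pre = "signed_preimage ?S \<sigma> \<epsilon>"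
  have p_W: "?p g w = - g (dot' (prm w))" and p_Wd: "?p g (dot w) = g (prm w)" if "w \<in> W" for g w
    using that \<epsilon>[of w] \<epsilon>'[of "dot w"] Wd
    by (auto simp: signed_pullback_def restr_def \<sigma>_W \<sigma>_Wd)
  have p_Mu: "?p g m = - g (uy m)" if "m \<in> Mu" for g m
    using that \<epsilon>[of m] by (auto simp: signed_pullback_def restr_def \<sigma>_Mu)
  have p_My: "?p g m = g (yu m)" if "m \<in> My" for g m
    using that \<epsilon>'[of m] by (auto simp: signed_pullback_def restr_def \<sigma>_My)
  have p_vecs: "?p g \<in> vecs Z" if "g \<in> vecs (\<sigma> ` Z)" "Z \<subseteq> ?S" for g Z
    using bij_betw_signed_pullback[OF inj nz that(2)] that(1) by (auto simp: bij_betw_def)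

  have genaut: "adjoint_genaut W dot prm dot' VWWd = ?pre ?T (orth ?T VWWd)"
  proof -
    have "(\<exists>f\<in>orth ?T VWWd. \<forall>w\<in>W. g (dot' (prm w)) = - f w \<and> g (prm w) = f (dot w))
        \<longleftrightarrow> ?p g \<in> orth ?T VWWd" (is "?L \<longleftrightarrow> ?R") if g: "g \<in> vecs (\<sigma> ` ?T)" for g
    proof
      assume ?L
      then obtain f where f: "f \<in> orth ?T VWWd"
        "\<And>w. w \<in> W \<Longrightarrow> g (dot' (prm w)) = - f w" "\<And>w. w \<in> W \<Longrightarrow> g (prm w) = f (dot w)"
        by auto
      have "?p g i = f i" for i
      proof (cases "i \<in> ?T")
        case True
        then show ?thesis
          using f(2,3) p_W p_Wd Wd by auto
      next
        case False
        then show ?thesis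
          using p_vecs[OF g] f(1) by (auto simp: orth_def vecs_def)
      qed
      then have "?p g = f" ..
      with f(1) show ?R by simp
    next
      assume ?R
      then show ?L
        using p_W p_Wd by (intro bexI[of _ "?p g"]) auto
    qed
    moreover have "prm ` W \<union> dot' ` prm ` W = \<sigma> ` ?T"
      by (simp add: W' Wd' image_Un img Un_commute)
    ultimately show ?thesis
      unfolding adjoint_genaut_def signed_preimage_def Wd by auto
  qed

  have gds: "adjoint_gds W Mu My dot prm dot' yu uy V = ?pre ?S (orth ?S V)"
  proof -
    have "(\<exists>f\<in>orth ?S V. (\<forall>w\<in>W. g (dot' (prm w)) = - f w \<and> g (prm w) = f (dot w)) \<and>
          (\<forall>m\<in>Mu. g (uy m) = - f m) \<and> (\<forall>m\<in>My. g (yu m) = f m))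
        \<longleftrightarrow> ?p g \<in> orth ?S V" (is "?L \<longleftrightarrow> ?R") if g: "g \<in> vecs (\<sigma> ` ?S)" for g
    proof
      assume ?L
      then obtain f where f: "f \<in> orth ?S V"
        "\<And>w. w \<in> W \<Longrightarrow> g (dot' (prm w)) = - f w" "\<And>w. w \<in> W \<Longrightarrow> g (prm w) = f (dot w)"
        "\<And>m. m \<in> Mu \<Longrightarrow> g (uy m) = - f m" "\<And>m. m \<in> My \<Longrightarrow> g (yu m) = f m"
        by auto
      have "?p g i = f i" for i
      proof (cases "i \<in> ?S")
        case True
        then show ?thesis
          using f(2-5) p_W p_Wd p_Mu p_My Wd by auto
      next
        case False
        then show ?thesis
          using p_vecs[OF g] f(1) by (auto simp: orth_def vecs_def)
      qed
      then have "?p g = f" ..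
      with f(1) show ?R by simp
    next
      assume ?R
      then show ?L
        using p_W p_Wd p_Mu p_My by (intro bexI[of _ "?p g"]) auto
    qed
    moreover have "prm ` W \<union> dot' ` prm ` W \<union> yu ` My \<union> uy ` Mu = \<sigma> ` ?S"
      by (auto simp: W' Wd' Mu' My' image_Un img)
    ultimately show ?thesis
      unfolding adjoint_gds_def signed_preimage_def Wd by auto
  qed

  have rel: "relabel W (dot' \<circ> prm) Mu uy (orth ?P VWMu) = ?pre ?P (orth ?P VWMu)"
  proof -
    have "(\<exists>f\<in>orth ?P VWMu. (\<forall>a\<in>W. g ((dot' \<circ> prm) a) = f a) \<and> (\<forall>b\<in>Mu. g (uy b) = f b))
        \<longleftrightarrow> ?p g \<in> orth ?P VWMu" (is "?L \<longleftrightarrow> ?R") if g: "g \<in> vecs (\<sigma> ` ?P)" for g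
    proof
      assume ?L
      then obtain f where f: "f \<in> orth ?P VWMu"
        "\<And>w. w \<in> W \<Longrightarrow> g (dot' (prm w)) = f w" "\<And>m. m \<in> Mu \<Longrightarrow> g (uy m) = f m"
        by auto
      \<comment> \<open>\<open>relabel\<close> keeps signs, whereas \<open>\<epsilon>\<close> is \<open>-1\<close> on all of \<open>?P\<close>\<close>
      have "?p g i = - f i" for i
      proof (cases "i \<in> ?P")
        case True
        then show ?thesis
          using f(2,3) p_W p_Mu by auto
      next
        case False
        then have "?p g i = 0" "f i = 0"
          using p_vecs[OF g] f(1) by (auto simp: orth_def vecs_def)
        then show ?thesis by simp
      qed
      then have "?p g = (\<lambda>i. - f i)" ..
      with vspace_on_uminus[OF vspace_on_orth f(1)] show ?R by simp
    next
      assume ?R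
      then show ?L
        using p_W p_Mu vspace_on_uminus[OF vspace_on_orth, of "?p g"]
        by (intro bexI[of _ "\<lambda>i. - ?p g i"]) auto
    qed
    moreover have "(dot' \<circ> prm) ` W \<union> uy ` Mu = \<sigma> ` ?P"
      by (simp only: image_comp[symmetric] W' Wd' My' image_Un img)
    ultimately show ?thesis
      unfolding relabel_def signed_preimage_def by auto
  qed

  let ?M = "meet ?S V ?P VWMu"
  have SP: "?S \<union> ?P = ?S"
    by auto
  have M: "vspace_on ?S ?M"
    using vspace_on_meet[OF assms(11,12)] by (simp only: SP)
  have orth_M: "orth ?S ?M = orth ?S V + orth ?P VWMu"
    using orth_meet[OF fin(1,2) assms(11,12)] by (simp only: SP)
  have T': "W' \<union> Wd' = \<sigma> ` ?T"
    by (auto simp: image_Un img)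

  have "VWWd = restriction ?M ?T \<longleftrightarrow> orth ?T VWWd = orth ?T (restriction ?M ?T)"
    using orth_eq_iff[OF fin(3) assms(13) vspace_on_restriction[OF M]] by simp
  also have "orth ?T (restriction ?M ?T) = contraction (orth ?S V + orth ?P VWMu) ?T"
    using orth_restriction[OF fin(1), of ?T ?M] orth_M by auto
  also have "orth ?T VWWd = \<dots> \<longleftrightarrow>
      ?pre ?T (orth ?T VWWd) = ?pre ?T (contraction (orth ?S V + orth ?P VWMu) ?T)"
    by (rule preimage_eq_iff[OF inj nz, symmetric]) (auto simp: orth_def contraction_def)
  also have "?pre ?T (contraction (orth ?S V + orth ?P VWMu) ?T)
      = contraction (?pre ?S (orth ?S V) + ?pre ?P (orth ?P VWMu)) (\<sigma> ` ?T)"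
    by (rule contraction_preimage_sum[OF inj nz, symmetric]) (auto simp: orth_def)
  finally show ?thesis
    unfolding genaut gds rel T' .
qed

end
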